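(* Surjectivity of $\bar\kappa$ is inherited by complemented subspaces: let $(\Omega,\Sigma,P)$ be a probability space, $E$ a locally convex space and $E_1\subset E$ a complemented subspace. If the map $\bar\kappa: L^0(\Omega\!:\!E')\to\mathcal{L}_{\rm c}(E\!:\!L^0(\Omega))$ is surjective, then the corresponding map $L^0(\Omega\!:\!E_1')\to\mathcal{L}_{\rm c}(E_1\!:\!L^0(\Omega))$ is surjective.
   Context: A locally convex space means a Hausdorff locally convex topological vector space over $\mathbb{R}$. A subspace $E_1$ of $E$ is complemented if it possesses a topological complement $E_2$, i.e. a subspace $E_2$ such that $E$ equals the topological direct sum $E_1\oplus E_2$ (subspaces carrying the induced topologies). For a locally convex space $F$, $F'$ denotes the space of sequentially continuous linear maps $F\to\mathbb{R}$, equipped with the $\sigma$-algebra generated by the evaluations $T\mapsto T(f)$, $f\in F$. $L^0(\Omega\!:\!F')$ is the space of measurable maps $\Omega\to F'$ modulo strict equivalence: $X_1,X_2$ are identified iff there is a set $\Omega_1\subset\Omega$ with $P(\Omega_1)=1$ and $X_1(\omega)=X_2(\omega)$ in $F'$ for all $\omega\in\Omega_1$. $L^0(\Omega)$ is the space of real-valued measurable functions on $\Omega$ modulo $P$-almost sure equality, with the topology of convergence in probability, and $\mathcal{L}_{\rm c}(F\!:\!L^0(\Omega))$ is the space of sequentially continuous linear maps $F\to L^0(\Omega)$. For each such $F$ the map $\bar\kappa: L^0(\Omega\!:\!F')\to\mathcal{L}_{\rm c}(F\!:\!L^0(\Omega))$ sends $[X]$ to the linear map $f\mapsto[\omega\mapsto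 X(\omega)(f)]$; it is well defined. *)

theory Defs
  imports "HOL-Probability.Probability"
begin

text \<open>
  A locally convex space is a topology \<open>F\<close> on a linear subspace \<open>topspace F\<close> of some real vector
  space, so that a subspace with its induced topology, \<open>subtopology F S\<close>, is again an
  object of the same kind.
\<close>

definition locally_convex_space :: "'a::real_vector topology \<Rightarrow> bool" where
  "locally_convex_space F \<longleftrightarrow>
     subspace (topspace F) \<and>
     continuous_map (prod_topology F F) F (\<lambda>(x, y). x + y) \<and>
     continuous_map (prod_topology euclideanreal F) F (\<lambda>(c, x). c *\<^sub>R x) \<and>
     Hausdorff_space F \<and>
     neighbourhood_base_at 0 convex F"

definition topological_direct_sum ::
  "'a::real_vector topology \<Rightarrow> 'a set \<Rightarrow> 'a set \<Rightarrow> bool" where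
  "topological_direct_sum F S1 S2 \<longleftrightarrow>
     homeomorphic_map (prod_topology (subtopology F S1) (subtopology F S2)) F (\<lambda>(x, y). x + y)"

definition complemented_subspace :: "'a::real_vector topology \<Rightarrow> 'a set \<Rightarrow> bool" where
  "complemented_subspace F S1 \<longleftrightarrow>
     subspace S1 \<and> S1 \<subseteq> topspace F \<and>
     (\<exists>S2. subspace S2 \<and> S2 \<subseteq> topspace F \<and> topological_direct_sum F S1 S2)"

definition sequentially_continuous_map ::
  "'a topology \<Rightarrow> 'b topology \<Rightarrow> ('a \<Rightarrow> 'b) \<Rightarrow> bool" where
  "sequentially_continuous_map X Y f \<longleftrightarrow>
     f \<in> topspace X \<rightarrow> topspace Y \<and>
     (\<forall>s l. range s \<subseteq> topspace X \<and> limitin X s l sequentially \<longrightarrow>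
        limitin Y (\<lambda>n. f (s n)) (f l) sequentially)"

text \<open>
  Maps defined on \<open>topspace F\<close> only are represented by extensional functions, so that equality
  of functionals is equality of their values on \<open>topspace F\<close>.
\<close>

definition dual_space :: "'a::real_vector topology \<Rightarrow> ('a \<Rightarrow> real) set" where
  "dual_space F = {T \<in> topspace F \<rightarrow>\<^sub>E UNIV.
     (\<forall>x\<in>topspace F. \<forall>y\<in>topspace F. T (x + y) = T x + T y) \<and>
     (\<forall>c. \<forall>x\<in>topspace F. T (c *\<^sub>R x) = c * T x) \<and>
     sequentially_continuous_map F euclideanreal T}"

definition dual_algebra :: "'a::real_vector topology \<Rightarrow> ('a \<Rightarrow> real) measure" where
  "dual_algebra F = sigma (dual_space F)
     {(\<lambda>T. T f) -` B \<inter> dual_space F | f B. f \<in> topspace F \<and> B \<in> sets borel}"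

definition strict_eq ::
  "'w measure \<Rightarrow> 'a::real_vector topology \<Rightarrow> (('w \<Rightarrow> 'a \<Rightarrow> real) \<times> ('w \<Rightarrow> 'a \<Rightarrow> real)) set" where
  "strict_eq M F = {(X, Y). X \<in> measurable M (dual_algebra F) \<and> Y \<in> measurable M (dual_algebra F) \<and>
     (\<exists>W\<in>sets M. measure M W = 1 \<and> (\<forall>w\<in>W. X w = Y w))}"

definition L0_dual ::
  "'w measure \<Rightarrow> 'a::real_vector topology \<Rightarrow> ('w \<Rightarrow> 'a \<Rightarrow> real) set set" where
  "L0_dual M F = measurable M (dual_algebra F) // strict_eq M F"

definition as_eq :: "'w measure \<Rightarrow> (('w \<Rightarrow> real) \<times> ('w \<Rightarrow> real)) set" where
  "as_eq M = {(f, g). f \<in> borel_measurable M \<and> g \<in> borel_measurable M \<and> (AE w in M. f w = g w)}"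

definition L0_class :: "'w measure \<Rightarrow> ('w \<Rightarrow> real) \<Rightarrow> ('w \<Rightarrow> real) set" where
  "L0_class M f = as_eq M `` {f}"

definition L0 :: "'w measure \<Rightarrow> ('w \<Rightarrow> real) set set" where
  "L0 M = borel_measurable M // as_eq M"

definition L0_add :: "'w measure \<Rightarrow> ('w \<Rightarrow> real) set \<Rightarrow> ('w \<Rightarrow> real) set \<Rightarrow> ('w \<Rightarrow> real) set" where
  "L0_add M A B = (\<Union>f\<in>A. \<Union>g\<in>B. L0_class M (\<lambda>w. f w + g w))"

definition L0_scale :: "'w measure \<Rightarrow> real \<Rightarrow> ('w \<Rightarrow> real) set \<Rightarrow> ('w \<Rightarrow> real) set" where
  "L0_scale M c A = (\<Union>f\<in>A. L0_class M (\<lambda>w. c * f w))"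

definition L0_ball :: "'w measure \<Rightarrow> ('w \<Rightarrow> real) set \<Rightarrow> real \<Rightarrow> ('w \<Rightarrow> real) set set" where
  "L0_ball M A e =
     {B \<in> L0 M. \<exists>f\<in>A. \<exists>g\<in>B. measure M {w \<in> space M. \<bar>f w - g w\<bar> > e} < e}"

text \<open>
  The topology of convergence in probability; \<open>limitin_L0_topology\<close> below identifies its
  convergent sequences.
\<close>

definition L0_topology :: "'w measure \<Rightarrow> ('w \<Rightarrow> real) set topology" where
  "L0_topology M = topology (\<lambda>U. U \<subseteq> L0 M \<and> (\<forall>A\<in>U. \<exists>e>0. L0_ball M A e \<subseteq> U))"

definition Lc_L0 ::
  "'w measure \<Rightarrow> 'a::real_vector topology \<Rightarrow> ('a \<Rightarrow> ('w \<Rightarrow> real) set) set" where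
  "Lc_L0 M F = {K \<in> topspace F \<rightarrow>\<^sub>E L0 M.
     (\<forall>x\<in>topspace F. \<forall>y\<in>topspace F. K (x + y) = L0_add M (K x) (K y)) \<and>
     (\<forall>c. \<forall>x\<in>topspace F. K (c *\<^sub>R x) = L0_scale M c (K x)) \<and>
     sequentially_continuous_map F (L0_topology M) K}"

text \<open>
  The union runs over the representatives of the class \<open>C\<close>, all of which give the same class of
  real random variables, see \<open>kappa_bar_class\<close> below.
\<close>

definition kappa_bar ::
  "'w measure \<Rightarrow> 'a::real_vector topology \<Rightarrow> ('w \<Rightarrow> 'a \<Rightarrow> real) set \<Rightarrow> 'a \<Rightarrow> ('w \<Rightarrow> real) set" where
  "kappa_bar M F C = (\<lambda>f\<in>topspace F. \<Union>X\<in>C. L0_class M (\<lambda>w. X w f))"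

lemma equiv_as_eq: "equiv (borel_measurable M) (as_eq M)"
proof (rule equivI)
  show "as_eq M \<subseteq> borel_measurable M \<times> borel_measurable M" by (auto simp: as_eq_def)
  show "refl_on (borel_measurable M) (as_eq M)" by (auto simp: as_eq_def refl_on_def)
  show "sym (as_eq M)" by (auto simp: as_eq_def sym_def eq_commute)
  show "trans (as_eq M)"
  proof (rule transI)
    fix f g h assume "(f, g) \<in> as_eq M" "(g, h) \<in> as_eq M"
    moreover then have "AE w in M. f w = g w" "AE w in M. g w = h w" by (auto simp: as_eq_def)
    then have "AE w in M. f w = h w" by eventually_elim simp
    ultimately show "(f, h) \<in> as_eq M" by (auto simp: as_eq_def)
  qed
qed

lemma (in prob_space) strict_eq_iff:
  "(X, Y) \<in> strict_eq M F \<longleftrightarrow>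
     X \<in> measurable M (dual_algebra F) \<and> Y \<in> measurable M (dual_algebra F) \<and> (AE w in M. X w = Y w)"
proof -
  have "(\<exists>W\<in>sets M. measure M W = 1 \<and> (\<forall>w\<in>W. X w = Y w)) \<longleftrightarrow> (AE w in M. X w = Y w)"
  proof
    assume "\<exists>W\<in>sets M. measure M W = 1 \<and> (\<forall>w\<in>W. X w = Y w)"
    then obtain W where W: "W \<in> sets M" "measure M W = 1" "\<forall>w\<in>W. X w = Y w" by auto
    have "AE w in M. w \<in> W" using W prob_eq_1[of W] by simp
    then show "AE w in M. X w = Y w" using W(3) by (auto elim: eventually_mono)
  next
    assume "AE w in M. X w = Y w"
    then obtain N where N: "{w \<in> space M. X w \<noteq> Y w} \<subseteq> N" "emeasure M N = 0" "N \<in> sets M"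
      by (rule AE_E)
    then have "measure M (space M - N) = 1"
      using prob_compl[of N] by (simp add: measure_def)
    then show "\<exists>W\<in>sets M. measure M W = 1 \<and> (\<forall>w\<in>W. X w = Y w)"
      using N by (intro bexI[of _ "space M - N"]) auto
  qed
  then show ?thesis by (auto simp: strict_eq_def)
qed

lemma (in prob_space) equiv_strict_eq:
  "equiv (measurable M (dual_algebra F)) (strict_eq M F)"
proof (rule equivI)
  show "strict_eq M F \<subseteq> measurable M (dual_algebra F) \<times> measurable M (dual_algebra F)"
    by (auto simp: strict_eq_def)
  show "refl_on (measurable M (dual_algebra F)) (strict_eq M F)"
    by (auto simp: strict_eq_iff refl_on_def)
  show "sym (strict_eq M F)" by (auto simp: strict_eq_iff sym_def eq_commute)
  show "trans (strict_eq M F)"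
  proof (rule transI)
    fix f g h assume "(f, g) \<in> strict_eq M F" "(g, h) \<in> strict_eq M F"
    moreover then have "AE w in M. f w = g w" "AE w in M. g w = h w" by (auto simp: strict_eq_iff)
    then have "AE w in M. f w = h w" by eventually_elim simp
    ultimately show "(f, h) \<in> strict_eq M F" by (auto simp: strict_eq_iff)
  qed
qed

lemma L0_class_eq_iff:
  assumes "f \<in> borel_measurable M" "g \<in> borel_measurable M"
  shows "L0_class M f = L0_class M g \<longleftrightarrow> (AE w in M. f w = g w)"
  using eq_equiv_class_iff[OF equiv_as_eq assms] assms by (simp add: L0_class_def as_eq_def)

lemma mem_L0_class:
  assumes "f \<in> borel_measurable M"
  shows "g \<in> L0_class M f \<longleftrightarrow> g \<in> borel_measurable M \<and> (AE w in M. f w = g w)"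
  using assms by (auto simp: L0_class_def as_eq_def)

lemma L0_class_in_L0: "f \<in> borel_measurable M \<Longrightarrow> L0_class M f \<in> L0 M"
  by (simp add: L0_def L0_class_def quotientI)

lemma L0_cases:
  assumes "A \<in> L0 M"
  obtains f where "f \<in> borel_measurable M" "A = L0_class M f"
  using assms by (auto simp: L0_def L0_class_def elim: quotientE)

lemma L0_add_class:
  assumes f: "f \<in> borel_measurable M" and g: "g \<in> borel_measurable M"
  shows "L0_add M (L0_class M f) (L0_class M g) = L0_class M (\<lambda>w. f w + g w)"
proof -
  have eq: "L0_class M (\<lambda>w. f' w + g' w) = L0_class M (\<lambda>w. f w + g w)"
    if "f' \<in> L0_class M f" "g' \<in> L0_class M g" for f' g'
  proof -
    have "AE w in M. f w = f' w" "AE w in M. g w = g' w" using that f g by (auto simp: mem_L0_class)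
    then have "AE w in M. f' w + g' w = f w + g w" by eventually_elim simp
    then show ?thesis using that f g by (subst L0_class_eq_iff) (auto simp: mem_L0_class)
  qed
  have "f \<in> L0_class M f" "g \<in> L0_class M g" using f g by (auto simp: mem_L0_class)
  then show ?thesis unfolding L0_add_def using eq by blast
qed

lemma L0_scale_class:
  assumes f: "f \<in> borel_measurable M"
  shows "L0_scale M c (L0_class M f) = L0_class M (\<lambda>w. c * f w)"
proof -
  have eq: "L0_class M (\<lambda>w. c * f' w) = L0_class M (\<lambda>w. c * f w)" if "f' \<in> L0_class M f" for f'
  proof -
    have "AE w in M. f w = f' w" using that f by (auto simp: mem_L0_class)
    then have "AE w in M. c * f' w = c * f w" by eventually_elim simp
    then show ?thesis using that f by (subst L0_class_eq_iff) (auto simp: mem_L0_class)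
  qed
  have "f \<in> L0_class M f" using f by (auto simp: mem_L0_class)
  then show ?thesis unfolding L0_scale_def using eq by blast
qed

lemma (in prob_space) L0_ball_class:
  assumes f: "f \<in> borel_measurable M" and g: "g \<in> borel_measurable M"
  shows "L0_class M g \<in> L0_ball M (L0_class M f) e \<longleftrightarrow>
           measure M {w \<in> space M. \<bar>f w - g w\<bar> > e} < e"
proof -
  have eq: "measure M {w \<in> space M. \<bar>f' w - g' w\<bar> > e} = measure M {w \<in> space M. \<bar>f w - g w\<bar> > e}"
    if "f' \<in> L0_class M f" "g' \<in> L0_class M g" for f' g'
  proof -
    have [measurable]: "f' \<in> borel_measurable M" "g' \<in> borel_measurable M"
      and ae: "AE w in M. f w = f' w" "AE w in M. g w = g' w" using that f g by (auto simp: mem_L0_class)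
    note [measurable] = f g
    show ?thesis
      by (rule measure_eq_AE) (use ae in \<open>eventually_elim, simp\<close>, measurable)
  qed
  have "f \<in> L0_class M f" "g \<in> L0_class M g" using f g by (auto simp: mem_L0_class)
  then show ?thesis using eq L0_class_in_L0[OF g] unfolding L0_ball_def
    by (smt (verit, best) mem_Collect_eq)
qed

lemma (in prob_space) L0_ball_mono:
  assumes "A \<in> L0 M" "d \<le> e"
  shows "L0_ball M A d \<subseteq> L0_ball M A e"
proof
  fix B assume B: "B \<in> L0_ball M A d"
  then have "B \<in> L0 M" by (simp add: L0_ball_def)
  then obtain g where g: "g \<in> borel_measurable M" "B = L0_class M g" by (rule L0_cases)
  obtain f where f: "f \<in> borel_measurable M" "A = L0_class M f" using assms(1) by (rule L0_cases)
  note [measurable] = f(1) g(1)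
  have "measure M {w \<in> space M. \<bar>f w - g w\<bar> > e} \<le> measure M {w \<in> space M. \<bar>f w - g w\<bar> > d}"
    using assms(2) by (intro finite_measure_mono) auto
  also have "\<dots> < d" using B f g by (simp add: L0_ball_class)
  finally show "B \<in> L0_ball M A e" using assms(2) f g by (simp add: L0_ball_class)
qed

lemma (in prob_space) openin_L0_topology:
  "openin (L0_topology M) U \<longleftrightarrow> U \<subseteq> L0 M \<and> (\<forall>A\<in>U. \<exists>e>0. L0_ball M A e \<subseteq> U)"
proof -
  have "istopology (\<lambda>U. U \<subseteq> L0 M \<and> (\<forall>A\<in>U. \<exists>e>0. L0_ball M A e \<subseteq> U))"
    unfolding istopology_def
  proof (intro conjI allI impI ballI; (elim conjE)?)
    fix S T A
    assume S: "S \<subseteq> L0 M" "\<forall>A\<in>S. \<exists>e>0. L0_ball M A e \<subseteq> S"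
      and T: "T \<subseteq> L0 M" "\<forall>A\<in>T. \<exists>e>0. L0_ball M A e \<subseteq> T" and A: "A \<in> S \<inter> T"
    obtain d e where "d > 0" "L0_ball M A d \<subseteq> S" "e > 0" "L0_ball M A e \<subseteq> T"
      using S T A by blast
    moreover have "A \<in> L0 M" using S A by auto
    ultimately show "\<exists>e>0. L0_ball M A e \<subseteq> S \<inter> T"
      using L0_ball_mono[of A "min d e" d] L0_ball_mono[of A "min d e" e]
      by (intro exI[of _ "min d e"]) auto
  next
    fix \<K> A
    assume K: "\<forall>K\<in>\<K>. K \<subseteq> L0 M \<and> (\<forall>A\<in>K. \<exists>e>0. L0_ball M A e \<subseteq> K)" and "A \<in> \<Union> \<K>"
    then obtain K e where "K \<in> \<K>" "e > 0" "L0_ball M A e \<subseteq> K" by blast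
    then show "\<exists>e>0. L0_ball M A e \<subseteq> \<Union> \<K>" by blast
  qed auto
  then show ?thesis by (simp add: L0_topology_def topology_inverse')
qed

lemma (in prob_space) topspace_L0_topology: "topspace (L0_topology M) = L0 M"
proof
  show "topspace (L0_topology M) \<subseteq> L0 M"
    using openin_topspace[of "L0_topology M"] unfolding openin_L0_topology by blast
  have "openin (L0_topology M) (L0 M)"
    unfolding openin_L0_topology by (auto simp: L0_ball_def intro: exI[of _ 1])
  then show "L0 M \<subseteq> topspace (L0_topology M)" by (rule openin_subset)
qed

lemma (in prob_space) L0_ball_neighbourhood:
  assumes f: "f \<in> borel_measurable M" and e: "e > 0"
  obtains U where "openin (L0_topology M) U" "L0_class M f \<in> U" "U \<subseteq> L0_ball M (L0_class M f) e"
proof -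
  define U where "U = {A \<in> L0 M. \<exists>d>0. L0_ball M A d \<subseteq> L0_ball M (L0_class M f) e}"
  have "\<exists>d>0. L0_ball M A d \<subseteq> U" if A: "A \<in> U" for A
  proof -
    obtain d where d: "d > 0" "L0_ball M A d \<subseteq> L0_ball M (L0_class M f) e" and "A \<in> L0 M"
      using A by (auto simp: U_def)
    then obtain g where g: "g \<in> borel_measurable M" "A = L0_class M g" by (auto elim: L0_cases)
    have "B \<in> U" if B: "B \<in> L0_ball M A (d/2)" for B
    proof -
      have "B \<in> L0 M" using B by (simp add: L0_ball_def)
      then obtain h where h: "h \<in> borel_measurable M" "B = L0_class M h" by (rule L0_cases)
      have "L0_ball M B (d/2) \<subseteq> L0_ball M A d"
      proof
        fix C assume C: "C \<in> L0_ball M B (d/2)"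
        then have "C \<in> L0 M" by (simp add: L0_ball_def)
        then obtain k where k: "k \<in> borel_measurable M" "C = L0_class M k" by (rule L0_cases)
        note [measurable] = g(1) h(1) k(1)
        have "measure M {w \<in> space M. \<bar>g w - k w\<bar> > d} \<le>
              measure M ({w \<in> space M. \<bar>g w - h w\<bar> > d/2} \<union> {w \<in> space M. \<bar>h w - k w\<bar> > d/2})"
          by (intro finite_measure_mono) (auto simp: abs_if split: if_splits)
        also have "\<dots> \<le> measure M {w \<in> space M. \<bar>g w - h w\<bar> > d/2} +
              measure M {w \<in> space M. \<bar>h w - k w\<bar> > d/2}"
          by (intro measure_Un_le) measurable
        also have "\<dots> < d/2 + d/2"
          using B C g h k by (intro add_strict_mono) (simp_all add: L0_ball_class)
        finally show "C \<in> L0_ball M A d" using g k by (simp add: L0_ball_class)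
      qed
      then show "B \<in> U" using d \<open>B \<in> L0 M\<close> by (auto simp: U_def intro!: exI[of _ "d/2"])
    qed
    then show ?thesis using d by (intro exI[of _ "d/2"]) auto
  qed
  then have "openin (L0_topology M) U"
    unfolding openin_L0_topology by (auto simp: U_def)
  moreover have "L0_class M f \<in> U" using e L0_class_in_L0[OF f] by (auto simp: U_def)
  moreover have "U \<subseteq> L0_ball M (L0_class M f) e"
  proof
    fix A assume A: "A \<in> U"
    then obtain d where d: "d > 0" "L0_ball M A d \<subseteq> L0_ball M (L0_class M f) e" "A \<in> L0 M"
      by (auto simp: U_def)
    then obtain g where "g \<in> borel_measurable M" "A = L0_class M g" by (auto elim: L0_cases)
    then have "A \<in> L0_ball M A d" using d by (simp add: L0_ball_class)
    then show "A \<in> L0_ball M (L0_class M f) e" using d by blast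
  qed
  ultimately show ?thesis by (rule that)
qed

lemma (in prob_space) limitin_L0_topology:
  assumes f: "\<And>n. f n \<in> borel_measurable M" and g: "g \<in> borel_measurable M"
  shows "limitin (L0_topology M) (\<lambda>n. L0_class M (f n)) (L0_class M g) sequentially \<longleftrightarrow>
    (\<forall>e>0. (\<lambda>n. measure M {w \<in> space M. \<bar>f n w - g w\<bar> > e}) \<longlonglongrightarrow> 0)" (is "?L \<longleftrightarrow> ?R")
proof
  note [measurable] = f g
  assume L: ?L
  have ev: "eventually (\<lambda>n. measure M {w \<in> space M. \<bar>f n w - g w\<bar> > d} < d) sequentially"
    if d: "d > 0" for d
  proof -
    obtain U where U: "openin (L0_topology M) U" "L0_class M g \<in> U" "U \<subseteq> L0_ball M (L0_class M g) d"
      using L0_ball_neighbourhood[OF g d] .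
    then have "eventually (\<lambda>n. L0_class M (f n) \<in> U) sequentially"
      using L by (auto simp: limitin_def)
    then show ?thesis
    proof eventually_elim
      case (elim n)
      then have "L0_class M (f n) \<in> L0_ball M (L0_class M g) d" using U by blast
      then show ?case using f g by (simp add: L0_ball_class abs_minus_commute)
    qed
  qed
  show ?R
  proof (intro allI impI)
    fix e :: real assume e: "e > 0"
    show "(\<lambda>n. measure M {w \<in> space M. \<bar>f n w - g w\<bar> > e}) \<longlonglongrightarrow> 0"
    proof (rule order_tendstoI)
      fix r :: real assume r: "0 < r"
      from ev[of "min e r"] e r
      have "eventually (\<lambda>n. measure M {w \<in> space M. \<bar>f n w - g w\<bar> > min e r} < min e r) sequentially"
        by simp
      then show "eventually (\<lambda>n. measure M {w \<in> space M. \<bar>f n w - g w\<bar> > e} < r) sequentially"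
      proof eventually_elim
        case (elim n)
        have "measure M {w \<in> space M. \<bar>f n w - g w\<bar> > e} \<le>
              measure M {w \<in> space M. \<bar>f n w - g w\<bar> > min e r}"
          by (intro finite_measure_mono) auto
        then show ?case using elim by linarith
      qed
    qed (auto intro!: always_eventually simp: less_le_trans[OF _ measure_nonneg])
  qed
next
  assume R: ?R
  show ?L unfolding limitin_def
  proof (intro conjI allI impI)
    show "L0_class M g \<in> topspace (L0_topology M)"
      using L0_class_in_L0[OF g] by (simp add: topspace_L0_topology)
    fix U assume "openin (L0_topology M) U \<and> L0_class M g \<in> U"
    then obtain e where e: "e > 0" "L0_ball M (L0_class M g) e \<subseteq> U"
      by (auto simp: openin_L0_topology)
    have "eventually (\<lambda>n. measure M {w \<in> space M. \<bar>f n w - g w\<bar> > e} < e) sequentially"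
      using R e(1) by (auto intro: order_tendstoD)
    then show "eventually (\<lambda>n. L0_class M (f n) \<in> U) sequentially"
    proof eventually_elim
      case (elim n)
      then have "L0_class M (f n) \<in> L0_ball M (L0_class M g) e"
        using f g by (simp add: L0_ball_class abs_minus_commute)
      then show ?case using e by blast
    qed
  qed
qed

lemma space_dual_algebra: "space (dual_algebra F) = dual_space F"
  by (simp add: dual_algebra_def space_measure_of_conv)

lemma measurable_eval_dual:
  assumes "X \<in> measurable M (dual_algebra F)" "f \<in> topspace F"
  shows "(\<lambda>w. X w f) \<in> borel_measurable M"
proof -
  have "(\<lambda>T. T f) \<in> borel_measurable (dual_algebra F)"
    by (rule measurableI)
       (use assms(2) in \<open>auto simp: dual_algebra_def space_measure_of_conv intro!: in_measure_of\<close>)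
  then show ?thesis using assms(1) by (rule measurable_compose[rotated])
qed

lemma (in prob_space) kappa_bar_class:
  assumes X: "X \<in> measurable M (dual_algebra F)" and f: "f \<in> topspace F"
  shows "kappa_bar M F (strict_eq M F `` {X}) f = L0_class M (\<lambda>w. X w f)"
proof -
  have eq: "L0_class M (\<lambda>w. Y w f) = L0_class M (\<lambda>w. X w f)" if "(X, Y) \<in> strict_eq M F" for Y
  proof -
    from that have Y: "Y \<in> measurable M (dual_algebra F)" "AE w in M. X w = Y w"
      by (auto simp: strict_eq_iff)
    from Y(2) have "AE w in M. Y w f = X w f" by eventually_elim simp
    then show ?thesis
      using L0_class_eq_iff measurable_eval_dual[OF X f] measurable_eval_dual[OF Y(1) f] by blast
  qed
  have "(X, X) \<in> strict_eq M F" using X by (simp add: strict_eq_iff)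
  then have "(\<Union>Y\<in>strict_eq M F `` {X}. L0_class M (\<lambda>w. Y w f)) = L0_class M (\<lambda>w. X w f)"
    by (intro UN_constant_eq[of X] ballI eq) (erule ImageI[OF _ singletonI], erule ImageE, blast)
  then show ?thesis using f by (simp only: kappa_bar_def restrict_apply if_True)
qed

lemma (in prob_space) kappa_bar_in_Lc_L0:
  assumes F: "locally_convex_space F" and C: "C \<in> L0_dual M F"
  shows "kappa_bar M F C \<in> Lc_L0 M F"
proof -
  obtain X where X: "X \<in> measurable M (dual_algebra F)" "C = strict_eq M F `` {X}"
    using C unfolding L0_dual_def by (rule quotientE)
  have dual: "X w \<in> dual_space F" if "w \<in> space M" for w
    using measurable_space[OF X(1) that] by (simp add: space_dual_algebra)
  have sub: "subspace (topspace F)" using F by (simp add: locally_convex_space_def)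
  note meas = measurable_eval_dual[OF X(1)]
  have val: "kappa_bar M F C f = L0_class M (\<lambda>w. X w f)" if "f \<in> topspace F" for f
    using kappa_bar_class[OF X(1) that] X(2) by simp
  have codom: "kappa_bar M F C \<in> topspace F \<rightarrow>\<^sub>E L0 M"
  proof (rule PiE_I)
    show "kappa_bar M F C f \<in> L0 M" if "f \<in> topspace F" for f
      using L0_class_in_L0[OF meas[OF that]] val[OF that] by simp
  qed (simp add: kappa_bar_def)
  moreover have "kappa_bar M F C (x + y) = L0_add M (kappa_bar M F C x) (kappa_bar M F C y)"
    if x: "x \<in> topspace F" and y: "y \<in> topspace F" for x y
  proof -
    have xy: "x + y \<in> topspace F" using sub x y by (rule subspace_add)
    have "AE w in M. X w (x + y) = X w x + X w y"
      using dual x y by (intro AE_I2) (auto simp: dual_space_def)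
    then have "L0_class M (\<lambda>w. X w (x + y)) = L0_class M (\<lambda>w. X w x + X w y)"
      using meas x y xy by (subst L0_class_eq_iff) auto
    then show ?thesis using meas x y xy by (simp add: val L0_add_class)
  qed
  moreover have "kappa_bar M F C (c *\<^sub>R x) = L0_scale M c (kappa_bar M F C x)"
    if x: "x \<in> topspace F" for c x
  proof -
    have cx: "c *\<^sub>R x \<in> topspace F" using sub x by (rule subspace_scale)
    have "AE w in M. X w (c *\<^sub>R x) = c * X w x"
      using dual x by (intro AE_I2) (auto simp: dual_space_def)
    then have "L0_class M (\<lambda>w. X w (c *\<^sub>R x)) = L0_class M (\<lambda>w. c * X w x)"
      using meas x cx by (subst L0_class_eq_iff) auto
    then show ?thesis using meas x cx by (simp add: val L0_scale_class)
  qed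
  moreover have "sequentially_continuous_map F (L0_topology M) (kappa_bar M F C)"
    unfolding sequentially_continuous_map_def
  proof (intro conjI allI impI; (elim conjE)?)
    show "kappa_bar M F C \<in> topspace F \<rightarrow> topspace (L0_topology M)"
      using codom by (auto simp: topspace_L0_topology)
    fix s l assume s: "range s \<subseteq> topspace F" and lim: "limitin F s l sequentially"
    have l: "l \<in> topspace F" using lim by (rule limitin_topspace)
    have sn: "s n \<in> topspace F" for n using s by auto
    note [measurable] = meas[OF l] meas[OF sn]
    have ptw: "(\<lambda>n. X w (s n)) \<longlonglongrightarrow> X w l" if "w \<in> space M" for w
      using dual[OF that] s lim by (auto simp: dual_space_def sequentially_continuous_map_def)
    have "(\<lambda>n. measure M {w \<in> space M. \<bar>X w (s n) - X w l\<bar> > e}) \<longlonglongrightarrow> 0" if e: "e > 0" for e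
    proof -
      have "(\<lambda>n. \<integral>w. indicator {w \<in> space M. \<bar>X w (s n) - X w l\<bar> > e} w \<partial>M) \<longlonglongrightarrow> (\<integral>w. (0::real) \<partial>M)"
      proof (rule integral_dominated_convergence[where w="\<lambda>_. 1"])
        show "AE w in M. (\<lambda>n. indicator {w \<in> space M. \<bar>X w (s n) - X w l\<bar> > e} w) \<longlonglongrightarrow> (0::real)"
        proof (intro AE_I2)
          fix w assume w: "w \<in> space M"
          have "eventually (\<lambda>n. dist (X w (s n)) (X w l) < e) sequentially"
            using ptw[OF w] e by (rule tendstoD)
          then have "eventually (\<lambda>n. indicator {w \<in> space M. \<bar>X w (s n) - X w l\<bar> > e} w = (0::real)) sequentially"
            by eventually_elim (auto simp: dist_real_def indicator_def)
          then show "(\<lambda>n. indicator {w \<in> space M. \<bar>X w (s n) - X w l\<bar> > e} w) \<longlonglongrightarrow> (0::real)"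
            by (rule tendsto_eventually)
        qed
      qed (auto simp: indicator_def)
      then show ?thesis by simp
    qed
    then have "limitin (L0_topology M) (\<lambda>n. L0_class M (\<lambda>w. X w (s n))) (L0_class M (\<lambda>w. X w l)) sequentially"
      by (subst limitin_L0_topology) (use meas sn l in auto)
    then show "limitin (L0_topology M) (\<lambda>n. kappa_bar M F C (s n)) (kappa_bar M F C l) sequentially"
      by (simp add: val sn l)
  qed
  ultimately show ?thesis by (simp add: Lc_L0_def)
qed

end

theory Submission
  imports Defs
begin

text \<open>
  The reason is functoriality. A continuous linear map \<open>q : G \<rightarrow> F\<close> acts by composition both on
  random functionals, \<open>X \<mapsto> X \<circ> q\<close>, and on sequentially continuous operators into \<open>L\<^sup>0\<close>,
  \<open>K \<mapsto> K \<circ> q\<close>, and \<open>\<kappa>\<close>-bar intertwines the two actions. Suppose in addition that \<open>p : F \<rightarrow> G\<close>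
  is continuous linear with \<open>p \<circ> q = id\<close>. Then every operator \<open>K\<close> on \<open>G\<close> equals \<open>(K \<circ> p) \<circ> q\<close>; if
  \<open>K \<circ> p\<close> is represented by a random functional \<open>X\<close> on \<open>F\<close>, then \<open>K\<close> is represented by
  \<open>X \<circ> q\<close>. So surjectivity passes from \<open>F\<close> to \<open>G\<close> (\<open>kappa_bar_surj_retract\<close>).

  For a complemented subspace, \<open>q\<close> is the inclusion and \<open>p\<close> the projection along the complement.
  The topology enters through the continuity of \<open>p\<close>, which is what a topological direct sum
  provides (\<open>complemented_subspace_projection\<close>).
\<close>

definition continuous_linear_map ::
  "'a::real_vector topology \<Rightarrow> 'b::real_vector topology \<Rightarrow> ('a \<Rightarrow> 'b) \<Rightarrow> bool" where
  "continuous_linear_map F G p \<longleftrightarrow>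
     continuous_map F G p \<and>
     (\<forall>x\<in>topspace F. \<forall>y\<in>topspace F. p (x + y) = p x + p y) \<and>
     (\<forall>c. \<forall>x\<in>topspace F. p (c *\<^sub>R x) = c *\<^sub>R p x)"

lemma continuous_linear_map_in_topspace:
  "continuous_linear_map F G p \<Longrightarrow> x \<in> topspace F \<Longrightarrow> p x \<in> topspace G"
  by (auto simp: continuous_linear_map_def dest: continuous_map_funspace)

lemma sequentially_continuous_map_compose:
  assumes p: "continuous_map X Y p" and f: "sequentially_continuous_map Y Z f"
  shows "sequentially_continuous_map X Z (compose (topspace X) f p)"
  unfolding sequentially_continuous_map_def
proof (intro conjI allI impI; (elim conjE)?)
  have pY: "p x \<in> topspace Y" if "x \<in> topspace X" for x
    using continuous_map_funspace[OF p] that by auto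
  show "compose (topspace X) f p \<in> topspace X \<rightarrow> topspace Z"
    using pY f by (auto simp: sequentially_continuous_map_def compose_def)
  fix s l assume s: "range s \<subseteq> topspace X" and lim: "limitin X s l sequentially"
  have "limitin Y (\<lambda>n. p (s n)) (p l) sequentially"
    using continuous_map_limit[OF p lim] by (simp add: o_def)
  moreover have "range (\<lambda>n. p (s n)) \<subseteq> topspace Y" using s pY by auto
  ultimately have "limitin Z (\<lambda>n. f (p (s n))) (f (p l)) sequentially"
    using f by (auto simp: sequentially_continuous_map_def)
  moreover have "l \<in> topspace X" using lim by (rule limitin_topspace)
  moreover have "s n \<in> topspace X" for n using s by auto
  ultimately show "limitin Z (\<lambda>n. compose (topspace X) f p (s n)) (compose (topspace X) f p l) sequentially"
    by (simp add: compose_def)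
qed

lemma dual_space_compose:
  assumes F: "subspace (topspace F)" and q: "continuous_linear_map F G q" and T: "T \<in> dual_space G"
  shows "compose (topspace F) T q \<in> dual_space F"
proof -
  have "sequentially_continuous_map F euclideanreal (compose (topspace F) T q)"
    using q T by (intro sequentially_continuous_map_compose[where Y = G])
      (auto simp: continuous_linear_map_def dual_space_def)
  then show ?thesis
    using q T F continuous_linear_map_in_topspace[OF q]
    by (auto simp: dual_space_def continuous_linear_map_def compose_def subspace_add subspace_scale)
qed

text \<open>
  It suffices to test measurability on the generating evaluations, and evaluating \<open>T \<circ> q\<close> at \<open>f\<close>
  is evaluating \<open>T\<close> at \<open>q f\<close>.
\<close>

lemma measurable_compose_dual:
  assumes F: "subspace (topspace F)" and q: "continuous_linear_map F G q"
    and X: "X \<in> measurable M (dual_algebra G)"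
  shows "(\<lambda>w. compose (topspace F) (X w) q) \<in> measurable M (dual_algebra F)"
  unfolding dual_algebra_def
proof (rule measurable_sigma_sets[OF sets_measure_of])
  have dual: "compose (topspace F) (X w) q \<in> dual_space F" if "w \<in> space M" for w
    using measurable_space[OF X that] by (intro dual_space_compose[OF F q]) (simp add: space_dual_algebra)
  then show "(\<lambda>w. compose (topspace F) (X w) q) \<in> space M \<rightarrow> dual_space F" by blast
  fix A assume "A \<in> {(\<lambda>T. T f) -` B \<inter> dual_space F | f B. f \<in> topspace F \<and> B \<in> sets borel}"
  then obtain f B where A: "A = (\<lambda>T. T f) -` B \<inter> dual_space F"
    and f: "f \<in> topspace F" and B: "B \<in> sets borel" by blast
  have "(\<lambda>w. compose (topspace F) (X w) q) -` A \<inter> space M = (\<lambda>w. X w (q f)) -` B \<inter> space M"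
    using dual f by (auto simp: A compose_eq)
  also have "\<dots> \<in> sets M"
    using measurable_eval_dual[OF X continuous_linear_map_in_topspace[OF q f]] B by (rule measurable_sets)
  finally show "(\<lambda>w. compose (topspace F) (X w) q) -` A \<inter> space M \<in> sets M" .
qed auto

lemma Lc_L0_compose:
  assumes F: "subspace (topspace F)" and p: "continuous_linear_map F G p" and K: "K \<in> Lc_L0 M G"
  shows "compose (topspace F) K p \<in> Lc_L0 M F"
proof -
  have "sequentially_continuous_map F (L0_topology M) (compose (topspace F) K p)"
    using p K by (intro sequentially_continuous_map_compose[where Y = G])
      (auto simp: continuous_linear_map_def Lc_L0_def)
  moreover have "compose (topspace F) K p \<in> topspace F \<rightarrow>\<^sub>E L0 M"
    using K continuous_linear_map_in_topspace[OF p] by (auto simp: Lc_L0_def compose_def)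
  ultimately show ?thesis
    using p K F continuous_linear_map_in_topspace[OF p]
    by (auto simp: Lc_L0_def continuous_linear_map_def compose_def subspace_add subspace_scale)
qed

text \<open>Naturality of \<open>\<kappa>\<close>-bar, at the level of representatives.\<close>

lemma (in prob_space) kappa_bar_compose:
  assumes F: "subspace (topspace F)" and q: "continuous_linear_map F G q"
    and X: "X \<in> measurable M (dual_algebra G)"
  shows "kappa_bar M F (strict_eq M F `` {\<lambda>w. compose (topspace F) (X w) q}) =
           compose (topspace F) (kappa_bar M G (strict_eq M G `` {X})) q"
proof
  fix f
  show "kappa_bar M F (strict_eq M F `` {\<lambda>w. compose (topspace F) (X w) q}) f =
          compose (topspace F) (kappa_bar M G (strict_eq M G `` {X})) q f"
  proof (cases "f \<in> topspace F")
    case True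
    then show ?thesis
      using kappa_bar_class[OF measurable_compose_dual[OF F q X] True]
        kappa_bar_class[OF X continuous_linear_map_in_topspace[OF q True]]
      by (simp add: compose_eq)
  next
    case False
    then show ?thesis by (simp add: kappa_bar_def compose_def)
  qed
qed

lemma (in prob_space) kappa_bar_surj_retract:
  assumes F: "subspace (topspace F)" and G: "subspace (topspace G)"
    and p: "continuous_linear_map F G p" and q: "continuous_linear_map G F q"
    and pq: "\<And>x. x \<in> topspace G \<Longrightarrow> p (q x) = x"
    and surj: "Lc_L0 M F \<subseteq> kappa_bar M F ` L0_dual M F"
  shows "Lc_L0 M G \<subseteq> kappa_bar M G ` L0_dual M G"
proof
  fix K assume K: "K \<in> Lc_L0 M G"
  then obtain C where C: "C \<in> L0_dual M F" "compose (topspace F) K p = kappa_bar M F C"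
    using Lc_L0_compose[OF F p K] surj by blast
  obtain X where X: "X \<in> measurable M (dual_algebra F)" "C = strict_eq M F `` {X}"
    using C(1) unfolding L0_dual_def by - (erule quotientE)
  define Y where "Y = (\<lambda>w. compose (topspace G) (X w) q)"
  have "kappa_bar M G (strict_eq M G `` {Y}) = compose (topspace G) (compose (topspace F) K p) q"
    using kappa_bar_compose[OF G q X(1)] C(2) X(2) by (simp add: Y_def)
  also have "\<dots> = K"
  proof (rule extensionalityI[where A = "topspace G"])
    show "K \<in> extensional (topspace G)" using K by (auto simp: Lc_L0_def PiE_def)
  qed (simp_all add: compose_eq pq continuous_linear_map_in_topspace[OF q])
  finally have "K = kappa_bar M G (strict_eq M G `` {Y})" ..
  moreover have "strict_eq M G `` {Y} \<in> L0_dual M G"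
    unfolding L0_dual_def Y_def by (rule quotientI) (rule measurable_compose_dual[OF G q X(1)])
  ultimately show "K \<in> kappa_bar M G ` L0_dual M G" by blast
qed

lemma locally_convex_space_subtopology:
  assumes F: "locally_convex_space F" and S: "subspace S" "S \<subseteq> topspace F"
  shows "locally_convex_space (subtopology F S)"
proof -
  have top: "topspace (subtopology F S) = S" using S(2) by auto
  have "continuous_map (prod_topology (subtopology F S) (subtopology F S)) F (\<lambda>(x, y). x + y)"
    using F by (simp add: locally_convex_space_def continuous_map_from_subtopology flip: subtopology_Times)
  moreover have "(\<lambda>(x, y). x + y) \<in> S \<times> S \<rightarrow> S"
    using subspace_add[OF S(1)] by auto
  ultimately have add:
    "continuous_map (prod_topology (subtopology F S) (subtopology F S)) (subtopology F S) (\<lambda>(x, y). x + y)"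
    by (simp only: continuous_map_in_subtopology topspace_prod_topology top simp_thms image_subset_iff_funcset)
  have "continuous_map (prod_topology euclideanreal (subtopology F S)) F (\<lambda>(c, x). c *\<^sub>R x)"
    using F by (simp add: locally_convex_space_def prod_topology_subtopology(2)
        continuous_map_from_subtopology)
  moreover have "(\<lambda>(c, x). c *\<^sub>R x) \<in> (UNIV :: real set) \<times> S \<rightarrow> S"
    using subspace_scale[OF S(1)] by auto
  ultimately have scale:
    "continuous_map (prod_topology euclideanreal (subtopology F S)) (subtopology F S) (\<lambda>(c, x). c *\<^sub>R x)"
    by (simp only: continuous_map_in_subtopology topspace_prod_topology topspace_euclidean top
        simp_thms image_subset_iff_funcset)
  have nhds: "neighbourhood_base_at 0 convex (subtopology F S)"
    unfolding neighbourhood_base_at_def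
  proof (intro allI impI; elim conjE)
    fix W assume "openin (subtopology F S) W" and W0: "0 \<in> W"
    then obtain W' where W': "openin F W'" "W = W' \<inter> S" by (auto simp: openin_subtopology)
    then obtain U V where "openin F U" "convex V" "0 \<in> U" "U \<subseteq> V" "V \<subseteq> W'"
      using F W0 unfolding locally_convex_space_def neighbourhood_base_at_def by blast
    then show "\<exists>U V. openin (subtopology F S) U \<and> convex V \<and> 0 \<in> U \<and> U \<subseteq> V \<and> V \<subseteq> W"
      using W' W0 subspace_imp_convex[OF S(1)]
      by (intro exI[of _ "U \<inter> S"] exI[of _ "V \<inter> S"])
        (auto intro!: openin_subtopology_Int convex_Int)
  qed
  show ?thesis
    using F S(1) add scale nhds unfolding locally_convex_space_def top by (simp add: Hausdorff_space_subtopology)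
qed

text \<open>
  The projection is the first component of the inverse of the homeomorphism \<open>(x, y) \<mapsto> x + y\<close>.
  Linearity comes from uniqueness of the decomposition, that is, from injectivity.
\<close>

lemma complemented_subspace_projection:
  assumes F: "subspace (topspace F)" and S1: "complemented_subspace F S1"
  obtains p where "continuous_linear_map F (subtopology F S1) p" "\<And>x. x \<in> S1 \<Longrightarrow> p x = x"
proof -
  obtain S2 where sub: "subspace S1" "subspace S2" "S1 \<subseteq> topspace F" "S2 \<subseteq> topspace F"
    and hom: "homeomorphic_map (prod_topology (subtopology F S1) (subtopology F S2)) F (\<lambda>(x, y). x + y)"
    using S1 by (auto simp: complemented_subspace_def topological_direct_sum_def)
  have top: "topspace (prod_topology (subtopology F S1) (subtopology F S2)) = S1 \<times> S2"
    using sub by auto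
  obtain h where "homeomorphic_maps (prod_topology (subtopology F S1) (subtopology F S2)) F
      (\<lambda>(x, y). x + y) h"
    using hom by (auto simp: homeomorphic_map_maps)
  then have h: "continuous_map F (prod_topology (subtopology F S1) (subtopology F S2)) h"
    and inv: "\<forall>w\<in>S1 \<times> S2. h ((\<lambda>(x, y). x + y) w) = w"
      "\<forall>z\<in>topspace F. (\<lambda>(x, y). x + y) (h z) = z"
    unfolding homeomorphic_maps_def top by blast+
  have hl: "h (x + y) = (x, y)" if "x \<in> S1" "y \<in> S2" for x y
    using inv(1) that by auto
  have hr: "fst (h z) + snd (h z) = z" if "z \<in> topspace F" for z
    using inv(2) that by (auto simp: split_beta)
  have dec: "\<exists>a\<in>S1. \<exists>b\<in>S2. z = a + b" if z: "z \<in> topspace F" for z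
  proof -
    have "h z \<in> S1 \<times> S2" using continuous_map_funspace[OF h] z top by auto
    then show ?thesis using hr[OF z]
      by (intro bexI[of _ "fst (h z)"] bexI[of _ "snd (h z)"]) (auto simp: mem_Times_iff)
  qed
  have "continuous_linear_map F (subtopology F S1) (\<lambda>z. fst (h z))"
    unfolding continuous_linear_map_def
  proof (intro conjI ballI allI)
    show "continuous_map F (subtopology F S1) (\<lambda>z. fst (h z))"
      using continuous_map_fst_of[OF h] by (simp add: o_def)
  next
    fix x y assume "x \<in> topspace F" "y \<in> topspace F"
    then obtain a b c d where *: "a \<in> S1" "b \<in> S2" "x = a + b" "c \<in> S1" "d \<in> S2" "y = c + d"
      using dec by metis
    have "x + y = (a + c) + (b + d)" using * by simp
    then have "h (x + y) = (a + c, b + d)" using hl * sub by (metis subspace_add)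
    then show "fst (h (x + y)) = fst (h x) + fst (h y)" using hl * by simp
  next
    fix c x assume "x \<in> topspace F"
    then obtain a b where *: "a \<in> S1" "b \<in> S2" "x = a + b" using dec by metis
    have "c *\<^sub>R x = c *\<^sub>R a + c *\<^sub>R b" using * by (simp add: scaleR_add_right)
    then have "h (c *\<^sub>R x) = (c *\<^sub>R a, c *\<^sub>R b)" using hl * sub by (metis subspace_scale)
    then show "fst (h (c *\<^sub>R x)) = c *\<^sub>R fst (h x)" using hl * by simp
  qed
  moreover have "fst (h x) = x" if "x \<in> S1" for x
    using hl[OF that subspace_0[OF sub(2)]] by simp
  ultimately show ?thesis by (rule that)
qed

theorem corollary6p5:
  fixes M :: "'w measure" and E :: "'a::real_vector topology" and E1 :: "'a set"
  assumes "prob_space M"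
    and "locally_convex_space E"
    and "complemented_subspace E E1"
    and "kappa_bar M E ` L0_dual M E = Lc_L0 M E"
  shows "kappa_bar M (subtopology E E1) ` L0_dual M (subtopology E E1) = Lc_L0 M (subtopology E E1)"
proof
  interpret prob_space M by fact
  have E1: "subspace E1" "E1 \<subseteq> topspace E" using assms(3) by (auto simp: complemented_subspace_def)
  have lc: "locally_convex_space (subtopology E E1)"
    using assms(2) E1 by (rule locally_convex_space_subtopology)
  have E: "subspace (topspace E)" and G: "subspace (topspace (subtopology E E1))"
    using assms(2) lc by (simp_all only: locally_convex_space_def)
  show "kappa_bar M (subtopology E E1) ` L0_dual M (subtopology E E1) \<subseteq> Lc_L0 M (subtopology E E1)"
    using kappa_bar_in_Lc_L0[OF lc] by blast
  obtain p where p: "continuous_linear_map E (subtopology E E1) p" "\<And>x. x \<in> E1 \<Longrightarrow> p x = x"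
    using complemented_subspace_projection[OF E assms(3)] by blast
  have "continuous_linear_map (subtopology E E1) E (\<lambda>x. x)"
    by (simp add: continuous_linear_map_def continuous_map_from_subtopology)
  then show "Lc_L0 M (subtopology E E1) \<subseteq> kappa_bar M (subtopology E E1) ` L0_dual M (subtopology E E1)"
    by (rule kappa_bar_surj_retract[OF E G p(1)]) (use p(2) assms(4) in auto)
qed

end
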